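(* Let $\hat s=(\hat s_0,\dots,\hat s_T)$, with $\hat s_0=s^*_0$, be the (random) levels of the store at the ends of the successive periods under the stochastic optimal control, let $s^*=(s^*_0,\dots,s^*_T)$ be the solution of the deterministic optimisation problem $\mathbf{P}$, and let the random variable $T'$ be the index of the first time period during which a shock occurs. Then, for all $t<T'$, $\hat s_t=s^*_t$.
   Context: Time periods are $t=1,\dots,T$. A store has capacity $E_t>0$ in period $t$, and input and output rate limits $P_{It},P_{Ot}\ge 0$; put $X_t=\{x\in\mathbb{R}:-P_{Ot}\le x\le P_{It}\}$. The cost of a planned change $x\in X_t$ of the store level in period $t$ is $C_t(x)$, with $C_t$ a real-valued convex function on $X_t$. For each $t$, $A_t$ is a given real-valued function of the planned level at the end of period $t$ (the expected additional cost of dealing optimally with any shock during period $t$). The initial level is $s^*_0$. Stochastic optimal control: define $V_T(s)=0$ for all possible levels $s$ and, for $t=T,\dots,1$, $$V_{t-1}(s_{t-1})=\min_{x_t\in X_t,\ s_{t-1}+x_t\in[0,E_t]}\bigl[C_t(x_t)+A_t(s_{t-1}+x_t)+V_t(s_{t-1}+x_t)\bigr]$$ (with value $+\infty$ if there is no feasible $x_t$; minima are assumed attained), and let $\hat x_t(s_{t-1})$ be the value of $x_t$ achieving this minimum. As long as no shock has occurred before period $t$, the optimal control plans the increment $\hat x_t(\hat s_{t-1})$ for period $t$. A shock in period $t$ is a random event which may perturb the level of the store. If no shock has occurred in any of the periods $1,\dots,t$, then $\hat s_t=\hat s_{t-1}+\hat x_t(\hat s_{t-1})$. If no shock ever occurs,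 $T'=T+1$. Problem $\mathbf{P}$: choose $s=(s_0,\dots,s_T)$ with $s_0=s^*_0$ so as to minimise $\sum_{t=1}^T[C_t(x_t(s))+A_t(s_t)]$, where $x_t(s)=s_t-s_{t-1}$, subject to $0\le s_t\le E_t$ and $x_t(s)\in X_t$ for $1\le t\le T$. As presupposed by the phrase "the solution", $\mathbf{P}$ is taken to be feasible with a unique solution. *)

theory Defs
  imports "HOL-Probability.Probability"
begin

definition rate_set :: "(nat \<Rightarrow> real) \<Rightarrow> (nat \<Rightarrow> real) \<Rightarrow> nat \<Rightarrow> real set" where
  "rate_set PI PO t = {- PO t..PI t}"

definition feasible_increments ::
    "(nat \<Rightarrow> real) \<Rightarrow> (nat \<Rightarrow> real set) \<Rightarrow> nat \<Rightarrow> real \<Rightarrow> real set" where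
  "feasible_increments E X t s = {x \<in> X t. s + x \<in> {0..E t}}"

text \<open>
  \<open>value_fn T E X C A t s\<close> is $V_t(s)$. An infimum over the empty set is \<open>\<infinity>\<close> in
  \<^typ>\<open>ereal\<close>; that the infimum is a minimum when the feasible set is nonempty is not part of
  the definition and has to be assumed separately.
\<close>

function value_fn ::
    "nat \<Rightarrow> (nat \<Rightarrow> real) \<Rightarrow> (nat \<Rightarrow> real set) \<Rightarrow> (nat \<Rightarrow> real \<Rightarrow> real) \<Rightarrow> (nat \<Rightarrow> real \<Rightarrow> real) \<Rightarrow>
     nat \<Rightarrow> real \<Rightarrow> ereal" where
  "value_fn T E X C A t s =
     (if T \<le> t then 0
      else INF x\<in>feasible_increments E X (Suc t) s.
             ereal (C (Suc t) x + A (Suc t) (s + x)) + value_fn T E X C A (Suc t) (s + x))"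
  by pat_completeness auto
termination
  by (relation "Wellfounded.measure (\<lambda>(T, E, X, C, A, t, s). T - t)") auto

declare value_fn.simps [simp del]

text \<open>The expression minimised over \<open>x\<close> in the equation for $V_{t-1}(s)$.\<close>

definition stage_cost ::
    "nat \<Rightarrow> (nat \<Rightarrow> real) \<Rightarrow> (nat \<Rightarrow> real set) \<Rightarrow> (nat \<Rightarrow> real \<Rightarrow> real) \<Rightarrow> (nat \<Rightarrow> real \<Rightarrow> real) \<Rightarrow>
     nat \<Rightarrow> real \<Rightarrow> real \<Rightarrow> ereal" where
  "stage_cost T E X C A t s x =
     ereal (C t x + A t (s + x)) + value_fn T E X C A t (s + x)"

text \<open>No capacity is associated with time 0, where only the given initial level is possible.\<close>

definition possible_levels :: "(nat \<Rightarrow> real) \<Rightarrow> real \<Rightarrow> nat \<Rightarrow> real set" where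
  "possible_levels E s0 t = (if t = 0 then {s0} else {0..E t})"

text \<open>
  \<open>xhat t s\<close> is a minimiser in the equation for $V_{t-1}(s)$, for every possible level \<open>s\<close> from
  which some increment is feasible; in particular all these minima are attained.
  Nothing is assumed about how ties are broken.
\<close>

definition optimal_control ::
    "nat \<Rightarrow> (nat \<Rightarrow> real) \<Rightarrow> (nat \<Rightarrow> real set) \<Rightarrow> (nat \<Rightarrow> real \<Rightarrow> real) \<Rightarrow> (nat \<Rightarrow> real \<Rightarrow> real) \<Rightarrow>
     real \<Rightarrow> (nat \<Rightarrow> real \<Rightarrow> real) \<Rightarrow> bool" where
  "optimal_control T E X C A s0 xhat \<longleftrightarrow>
     (\<forall>t\<in>{1..T}. \<forall>s\<in>possible_levels E s0 (t - 1).
        feasible_increments E X t s \<noteq> {} \<longrightarrow>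
        is_arg_min (stage_cost T E X C A t s) (\<lambda>x. x \<in> feasible_increments E X t s) (xhat t s))"

text \<open>
  A vector \<open>(s\<^sub>0, \<dots>, s\<^sub>T)\<close> is represented by a function on \<^typ>\<open>nat\<close>, of which only the values
  at arguments up to \<open>T\<close> matter.
\<close>

definition P_feasible ::
    "nat \<Rightarrow> (nat \<Rightarrow> real) \<Rightarrow> (nat \<Rightarrow> real set) \<Rightarrow> real \<Rightarrow> (nat \<Rightarrow> real) \<Rightarrow> bool" where
  "P_feasible T E X s0 s \<longleftrightarrow>
     s 0 = s0 \<and> (\<forall>t\<in>{1..T}. 0 \<le> s t \<and> s t \<le> E t \<and> s t - s (t - 1) \<in> X t)"

definition P_objective ::
    "nat \<Rightarrow> (nat \<Rightarrow> real \<Rightarrow> real) \<Rightarrow> (nat \<Rightarrow> real \<Rightarrow> real) \<Rightarrow> (nat \<Rightarrow> real) \<Rightarrow> real" where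
  "P_objective T C A s = (\<Sum>t = 1..T. C t (s t - s (t - 1)) + A t (s t))"

definition P_solution ::
    "nat \<Rightarrow> (nat \<Rightarrow> real) \<Rightarrow> (nat \<Rightarrow> real set) \<Rightarrow> (nat \<Rightarrow> real \<Rightarrow> real) \<Rightarrow> (nat \<Rightarrow> real \<Rightarrow> real) \<Rightarrow>
     real \<Rightarrow> (nat \<Rightarrow> real) \<Rightarrow> bool" where
  "P_solution T E X C A s0 s \<longleftrightarrow> is_arg_min (P_objective T C A) (P_feasible T E X s0) s"

text \<open>\<open>shock t\<close> is the event that a shock occurs during period \<open>t\<close>.\<close>

definition first_shock :: "nat \<Rightarrow> (nat \<Rightarrow> 'w set) \<Rightarrow> 'w \<Rightarrow> nat" where
  "first_shock T shock \<omega> =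
     (if \<exists>t\<in>{1..T}. \<omega> \<in> shock t then LEAST t. t \<in> {1..T} \<and> \<omega> \<in> shock t else T + 1)"

end

theory Submission
  imports Defs
begin

text \<open>
  This is Bellman's principle of optimality. Until the first shock the stochastic control follows
  the deterministic recursion that starts at \<open>s0\<close> and always applies \<open>xhat\<close>. The value \<open>V\<^sub>0(s0)\<close>
  bounds from below the objective of every feasible path of the deterministic problem
  (\<open>value_fn_le_tail_cost\<close>: each step of a path is one candidate in the minimisation that defines
  the value function), and the recursive path attains it (\<open>controlled_levels_optimality\<close>: each step
  realises the minimum). So this path solves the deterministic problem, and uniqueness identifies
  it with \<open>sstar\<close>.

  The value function may be \<open>\<infinity>\<close>, and the control is constrained only where some increment is
  feasible. Both difficulties are settled by carrying the bound \<open>V\<^sub>t < \<infinity>\<close> along the recursive path.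
  It starts with \<open>V\<^sub>0(s0) < \<infinity>\<close>, which holds because a feasible path exists; it forces the feasible
  set at the current level to be nonempty, and it passes to the next level because the two values
  differ by a real cost.
\<close>

primrec controlled_levels :: "(nat \<Rightarrow> real \<Rightarrow> real) \<Rightarrow> real \<Rightarrow> nat \<Rightarrow> real" where
  "controlled_levels f s0 0 = s0"
| "controlled_levels f s0 (Suc t) =
     controlled_levels f s0 t + f (Suc t) (controlled_levels f s0 t)"

lemma value_fn_horizon: "value_fn T E X C A T s = 0"
  by (simp add: value_fn.simps)

lemma value_fn_step:
  assumes "t < T"
  shows "value_fn T E X C A t s =
           (INF x\<in>feasible_increments E X (Suc t) s. stage_cost T E X C A (Suc t) s x)"
  using assms by (subst value_fn.simps) (simp add: stage_cost_def)

lemma value_fn_finite_imp_feasible: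
  assumes "t < T" and "value_fn T E X C A t s < \<infinity>"
  shows "feasible_increments E X (Suc t) s \<noteq> {}"
  using assms by (auto simp: value_fn_step top_ereal_def)

lemma value_fn_eq_stage_cost:
  assumes "t < T"
    and min: "is_arg_min (stage_cost T E X C A (Suc t) s)
                (\<lambda>x. x \<in> feasible_increments E X (Suc t) s) x"
  shows "value_fn T E X C A t s = stage_cost T E X C A (Suc t) s x"
proof -
  have "(INF y\<in>feasible_increments E X (Suc t) s. stage_cost T E X C A (Suc t) s y) =
          stage_cost T E X C A (Suc t) s x"
    using min by (intro INF_eqI) (auto simp: is_arg_min_linorder)
  with \<open>t < T\<close> show ?thesis
    by (simp add: value_fn_step)
qed

text \<open>
  Backward induction on the time: the increment that the path makes in the next period competes
  in the infimum that defines the value function.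
\<close>

lemma value_fn_le_tail_cost:
  assumes feas: "P_feasible T E X s0 s" and "t \<le> T"
  shows "value_fn T E X C A t (s t) \<le>
           ereal (\<Sum>u = Suc t..T. C u (s u - s (u - 1)) + A u (s u))"
  using \<open>t \<le> T\<close>
proof (induction t rule: inc_induct)
  case base
  show ?case by (simp add: value_fn_horizon zero_ereal_def)
next
  case (step t)
  let ?x = "s (Suc t) - s t"
  let ?c = "C (Suc t) ?x + A (Suc t) (s (Suc t))"
  have "Suc t \<in> {1..T}" using step.hyps by simp
  with feas have "?x \<in> feasible_increments E X (Suc t) (s t)"
    unfolding P_feasible_def feasible_increments_def by fastforce
  then have "value_fn T E X C A t (s t) \<le> stage_cost T E X C A (Suc t) (s t) ?x"
    using step.hyps by (simp add: value_fn_step INF_lower)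
  also have "\<dots> = ereal ?c + value_fn T E X C A (Suc t) (s (Suc t))"
    by (simp add: stage_cost_def)
  also have "\<dots> \<le> ereal ?c +
      ereal (\<Sum>u = Suc (Suc t)..T. C u (s u - s (u - 1)) + A u (s u))"
    by (intro add_left_mono step.IH)
  also have "\<dots> = ereal (\<Sum>u = Suc t..T. C u (s u - s (u - 1)) + A u (s u))"
    using step.hyps by (simp add: sum.atLeast_Suc_atMost)
  finally show ?case .
qed

text \<open>
  The first two conclusions carry the induction: finiteness makes the next increment feasible, so
  that the control is a minimiser there, and feasibility makes the current level one of those at
  which the control is known to be optimal. The third telescopes the Bellman equations; at the
  horizon it says that the path costs exactly \<open>V\<^sub>0(s0)\<close>.
\<close>

lemma controlled_levels_optimality:
  assumes opt: "optimal_control T E X C A s0 f"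
    and fin: "value_fn T E X C A 0 s0 < \<infinity>"
    and "t \<le> T"
  defines "r \<equiv> controlled_levels f s0"
  shows "P_feasible t E X s0 r \<and>
         value_fn T E X C A t (r t) < \<infinity> \<and>
         value_fn T E X C A 0 s0 = ereal (P_objective t C A r) + value_fn T E X C A t (r t)"
  using \<open>t \<le> T\<close>
proof (induction t)
  case 0
  show ?case
    using fin by (simp add: P_feasible_def P_objective_def r_def flip: zero_ereal_def)
next
  case (Suc t)
  let ?V = "value_fn T E X C A"
  let ?x = "f (Suc t) (r t)"
  let ?c = "C (Suc t) ?x + A (Suc t) (r (Suc t))"
  from Suc have "t < T" and feas: "P_feasible t E X s0 r" and fin_t: "?V t (r t) < \<infinity>"
    and total: "?V 0 s0 = ereal (P_objective t C A r) + ?V t (r t)"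
    by auto
  have next_level: "r (Suc t) = r t + ?x"
    by (simp add: r_def)
  have "r t \<in> possible_levels E s0 t"
    using feas by (auto simp: possible_levels_def P_feasible_def)
  moreover have "feasible_increments E X (Suc t) (r t) \<noteq> {}"
    using \<open>t < T\<close> fin_t by (rule value_fn_finite_imp_feasible)
  moreover have "Suc t \<in> {1..T}"
    using \<open>t < T\<close> by simp
  ultimately have min: "is_arg_min (stage_cost T E X C A (Suc t) (r t))
                          (\<lambda>x. x \<in> feasible_increments E X (Suc t) (r t)) ?x"
    using opt unfolding optimal_control_def by fastforce
  then have "?x \<in> feasible_increments E X (Suc t) (r t)"
    by (simp add: is_arg_min_def)
  with feas have feas': "P_feasible (Suc t) E X s0 r"
    by (auto simp: P_feasible_def feasible_increments_def next_level le_Suc_eq)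
  have bellman: "?V t (r t) = ereal ?c + ?V (Suc t) (r (Suc t))"
    using value_fn_eq_stage_cost[OF \<open>t < T\<close> min] by (simp add: stage_cost_def next_level)
  have fin': "?V (Suc t) (r (Suc t)) < \<infinity>"
    using fin_t bellman by (cases "?V (Suc t) (r (Suc t))") auto
  have "P_objective (Suc t) C A r = P_objective t C A r + ?c"
    by (simp add: P_objective_def next_level)
  then have "?V 0 s0 = ereal (P_objective (Suc t) C A r) + ?V (Suc t) (r (Suc t))"
    by (simp add: total bellman flip: add.assoc)
  with feas' fin' show ?case by blast
qed

lemma controlled_levels_P_solution:
  assumes opt: "optimal_control T E X C A s0 f"
    and feas: "P_feasible T E X s0 s"
  shows "P_solution T E X C A s0 (controlled_levels f s0)"
proof -
  have bound: "value_fn T E X C A 0 s0 \<le> ereal (P_objective T C A q)"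
    if "P_feasible T E X s0 q" for q
    using value_fn_le_tail_cost[OF that, of 0 C A] that
    by (simp add: P_objective_def P_feasible_def)
  have "value_fn T E X C A 0 s0 < \<infinity>"
    using bound[OF feas] by (rule le_less_trans) simp
  from controlled_levels_optimality[OF opt this order_refl]
  have "P_feasible T E X s0 (controlled_levels f s0)"
    and "value_fn T E X C A 0 s0 = ereal (P_objective T C A (controlled_levels f s0))"
    by (simp_all add: value_fn_horizon)
  with bound show ?thesis
    by (auto simp: P_solution_def is_arg_min_linorder)
qed

lemma before_first_shock:
  assumes "t < first_shock T shock \<omega>"
  shows "t \<le> T" and "\<forall>u\<in>{1..t}. \<omega> \<notin> shock u"
proof -
  let ?shocked = "\<lambda>t. t \<in> {1..T} \<and> \<omega> \<in> shock t"
  have "t \<le> T \<and> (\<forall>u\<in>{1..t}. \<omega> \<notin> shock u)"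
  proof (cases "\<exists>t. ?shocked t")
    case True
    then have lt: "t < (LEAST t. ?shocked t)"
      using assms by (auto simp: first_shock_def split: if_splits)
    moreover have "(LEAST t. ?shocked t) \<le> T"
      using LeastI_ex[OF True] by simp
    moreover have "\<not> ?shocked u" if "u \<le> t" for u
      using lt that by (intro not_less_Least) simp
    ultimately show ?thesis by auto
  next
    case False
    then have "first_shock T shock \<omega> = T + 1"
      by (auto simp: first_shock_def)
    with assms False show ?thesis by auto
  qed
  then show "t \<le> T" and "\<forall>u\<in>{1..t}. \<omega> \<notin> shock u" by auto
qed

theorem proposition4:
  fixes T :: nat
    and E PI PO :: "nat \<Rightarrow> real"
    and X :: "nat \<Rightarrow> real set"
    and C A :: "nat \<Rightarrow> real \<Rightarrow> real"
    and s0 :: real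
    and xhat :: "nat \<Rightarrow> real \<Rightarrow> real"
    and sstar :: "nat \<Rightarrow> real"
    and M :: "'w measure"
    and shock :: "nat \<Rightarrow> 'w set"
    and shat :: "nat \<Rightarrow> 'w \<Rightarrow> real"
    and T' :: "'w \<Rightarrow> nat"
  assumes "T \<ge> 1"
    and "\<And>t. t \<in> {1..T} \<Longrightarrow> E t > 0"
    and "\<And>t. t \<in> {1..T} \<Longrightarrow> PI t \<ge> 0"
    and "\<And>t. t \<in> {1..T} \<Longrightarrow> PO t \<ge> 0"
    and "X = rate_set PI PO"
    and "\<And>t. t \<in> {1..T} \<Longrightarrow> convex_on (X t) (C t)"
    and "optimal_control T E X C A s0 xhat"
    and "P_solution T E X C A s0 sstar"
    and "\<And>s. P_solution T E X C A s0 s \<Longrightarrow> \<forall>t\<in>{0..T}. s t = sstar t"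
    and "prob_space M"
    and "\<And>t. t \<in> {1..T} \<Longrightarrow> shock t \<in> sets M"
    and "\<And>t. t \<in> {0..T} \<Longrightarrow> shat t \<in> borel_measurable M"
    and "\<And>\<omega>. \<omega> \<in> space M \<Longrightarrow> shat 0 \<omega> = s0"
    and "\<And>t \<omega>. t \<in> {1..T} \<Longrightarrow> \<omega> \<in> space M \<Longrightarrow> \<forall>u\<in>{1..t}. \<omega> \<notin> shock u \<Longrightarrow>
           shat t \<omega> = shat (t - 1) \<omega> + xhat t (shat (t - 1) \<omega>)"
    and "T' = first_shock T shock"
  shows "\<forall>\<omega>\<in>space M. \<forall>t. t < T' \<omega> \<longrightarrow> shat t \<omega> = sstar t"
proof (intro ballI allI impI)
  fix \<omega> t
  assume \<omega>: "\<omega> \<in> space M" and "t < T' \<omega>"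
  then have "t < first_shock T shock \<omega>"
    using assms(15) by simp
  note before = before_first_shock[OF this]
  have "shat u \<omega> = controlled_levels xhat s0 u" if "u \<le> t" for u
    using that
  proof (induction u)
    case 0
    show ?case using assms(13)[OF \<omega>] by simp
  next
    case (Suc u)
    have "Suc u \<in> {1..T}" and "\<forall>v\<in>{1..Suc u}. \<omega> \<notin> shock v"
      using Suc.prems before by auto
    from assms(14)[OF this(1) \<omega> this(2)] Suc show ?case by simp
  qed
  moreover have "P_feasible T E X s0 sstar"
    using assms(8) by (simp add: P_solution_def is_arg_min_def)
  then have "\<forall>u\<in>{0..T}. controlled_levels xhat s0 u = sstar u"
    by (intro assms(9) controlled_levels_P_solution[OF assms(7)])
  ultimately show "shat t \<omega> = sstar t"
    using before(1) by simp
qed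

end
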